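(* Let $C(\Phi_j,G)$, $j=1,2$, be two Boolean models on $\mathbb{R}^d$ with point processes of germs $\Phi_1,\Phi_2$, respectively, and $G$ as the common distribution of the typical grain. Assume that $\Phi_1,\Phi_2$ are simple and have locally finite moment measures. If $\Phi_1\le_{dcx}\Phi_2$, then $\overline r_c(\Phi_1,G)\le\overline r_c(\Phi_2,G)$. Moreover, if $G$ is a fixed (deterministic) compact grain, then the same conclusion holds provided $\nu_1(B)\le\nu_2(B)$ for all bounded Borel sets $B\subset\mathbb{R}^d$, where $\nu_j(B)=\mathsf{P}(\Phi_j(B)=0)$ is the void probability of $\Phi_j$.
   Context: A point process on $\mathbb{R}^d$ is a random locally finite counting measure, assumed to have Radon mean measure. Its $k$-th moment measure is determined by $\alpha^k(B_1\times\dots\times B_k)=\mathsf{E}\prod_{i=1}^k\Phi(B_i)$. Given a point process $\Phi$ and a random closed set $G$, the Boolean model is $C(\Phi,G)=\bigcup_{X_i\in\Phi}(X_i+G_i)$, where given $\Phi$ the $G_i$ are i.i.d. copies of $G$. All Boolean models are assumed to be locally finite: for every compact $K$ the expected number of germs $X_i$ with $(X_i+G_i)\cap K\neq\emptyset$ is finite. For $r\ge0$, $G^{(r)}=\bigcup_{x\in G}B_x(r)$, where $B_x(r)$ is the ball of radius $r$ centered at $x$. For $n\in\mathbb{N}$ let $\mathbb{L}^{*d}_n$ be the close-packed lattice graph with vertex set $\mathbb{Z}^d_n=\frac1n\mathbb{Z}^d$, where two vertices $z,z'$ are joined if $\bigl(z+(-\tfrac1n,\tfrac1n]^d\bigr)\cap\bigl(z'+(-\tfrac1n,\tfrac1n]^d\bigr)\ne\emptyset$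 (i.e. $\|z-z'\|_\infty\le 1/n$). A contour in $\mathbb{L}^{*d}_n$ is a minimal collection of vertices such that any infinite (self-avoiding) path in $\mathbb{L}^{*d}_n$ from the origin contains one of these vertices; $\Gamma_n$ is the set of all contours. For $\gamma\subset\mathbb{Z}^d_n$ put $Q_\gamma=\bigcup_{z\in\gamma}\bigl(z+(-\tfrac1{2n},\tfrac1{2n}]^d\bigr)$. Then $$\overline r_c(\Phi,G)=\inf\Bigl\{r>0:\text{ for all } n\ge1,\ \sum_{\gamma\in\Gamma_n}\mathsf{P}\bigl(C(\Phi,G^{(r)})\cap Q_\gamma=\emptyset\bigr)<\infty\Bigr\},\qquad \inf\emptyset=+\infty.$$ A Lebesgue-measurable $f:\mathbb{R}^k\to\mathbb{R}$ is directionally convex ($dcx$) if for all $x,y,p,q\in\mathbb{R}^k$ with $p\le x\le q$, $p\le y\le q$ (coordinatewise) and $x+y=p+q$ one has $f(x)+f(y)\le f(p)+f(q)$. $\Phi_1\le_{dcx}\Phi_2$ means that for every $k\ge1$ and all bounded Borel $B_1,\dots,B_k\subset\mathbb{R}^d$, $\mathsf{E}f(\Phi_1(B_1),\dots,\Phi_1(B_k))\le\mathsf{E}f(\Phi_2(B_1),\dots,\Phi_2(B_k))$ for all $dcx$ functions $f$ for which both expectations are finite. *)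

theory Defs
  imports "HOL-Probability.Probability"
begin

section \<open>Point processes\<close>

abbreviation bounded_borel :: "(real ^ 'd) set \<Rightarrow> bool" where
  "bounded_borel B \<equiv> B \<in> sets borel \<and> bounded B"

text \<open>
  A point process is a random locally finite counting measure, i.e. a random Borel measure
  that takes finite integer values on bounded Borel sets; its mean measure is Radon.
\<close>

definition point_process :: "'w measure \<Rightarrow> ('w \<Rightarrow> (real ^ 'd) measure) \<Rightarrow> bool" where
  "point_process M \<Phi> \<longleftrightarrow>
     prob_space M \<and>
     (\<forall>\<omega>\<in>space M. sets (\<Phi> \<omega>) = sets borel \<and>
        (\<forall>B. bounded_borel B \<longrightarrow> emeasure (\<Phi> \<omega>) B \<in> \<nat>)) \<and>
     (\<forall>B\<in>sets borel. (\<lambda>\<omega>. emeasure (\<Phi> \<omega>) B) \<in> borel_measurable M) \<and>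
     (\<forall>B. bounded_borel B \<longrightarrow> (\<integral>\<^sup>+\<omega>. emeasure (\<Phi> \<omega>) B \<partial>M) < \<infinity>)"

definition simple_process :: "'w measure \<Rightarrow> ('w \<Rightarrow> (real ^ 'd) measure) \<Rightarrow> bool" where
  "simple_process M \<Phi> \<longleftrightarrow> (AE \<omega> in M. \<forall>x. emeasure (\<Phi> \<omega>) {x} \<le> 1)"

text \<open>The value of the \<open>k\<close>-th moment measure on \<open>B 0 \<times> \<dots> \<times> B (k - 1)\<close>.\<close>

definition moment :: "'w measure \<Rightarrow> ('w \<Rightarrow> (real ^ 'd) measure) \<Rightarrow> nat \<Rightarrow> (nat \<Rightarrow> (real ^ 'd) set) \<Rightarrow> ennreal"
  where "moment M \<Phi> k B = (\<integral>\<^sup>+\<omega>. (\<Prod>i<k. emeasure (\<Phi> \<omega>) (B i)) \<partial>M)"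

text \<open>
  Every bounded subset of \<open>(\<real>\<^sup>d)\<^sup>k\<close> lies in a bounded rectangle, so it suffices to look at these.
\<close>

definition locally_finite_moments :: "'w measure \<Rightarrow> ('w \<Rightarrow> (real ^ 'd) measure) \<Rightarrow> bool" where
  "locally_finite_moments M \<Phi> \<longleftrightarrow>
     (\<forall>k\<ge>1. \<forall>B. (\<forall>i<k. bounded_borel (B i)) \<longrightarrow> moment M \<Phi> k B < \<infinity>)"

definition void_prob :: "'w measure \<Rightarrow> ('w \<Rightarrow> (real ^ 'd) measure) \<Rightarrow> (real ^ 'd) set \<Rightarrow> real" where
  "void_prob M \<Phi> B = measure M {\<omega> \<in> space M. emeasure (\<Phi> \<omega>) B = 0}"


section \<open>The directionally convex order\<close>

text \<open>
  \<open>\<real>\<^sup>k\<close> is the set \<open>{..<k} \<rightarrow>\<^sub>E UNIV\<close> of extensional functions, since \<open>k\<close> is quantified over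
  in the order below. Its Lebesgue sets are those of the completed product measure.
\<close>

definition dcx :: "nat \<Rightarrow> ((nat \<Rightarrow> real) \<Rightarrow> real) \<Rightarrow> bool" where
  "dcx k f \<longleftrightarrow>
     f \<in> borel_measurable (completion (Pi\<^sub>M {..<k} (\<lambda>_. lborel))) \<and>
     (\<forall>x \<in> {..<k} \<rightarrow>\<^sub>E UNIV. \<forall>y \<in> {..<k} \<rightarrow>\<^sub>E UNIV. \<forall>p \<in> {..<k} \<rightarrow>\<^sub>E UNIV. \<forall>q \<in> {..<k} \<rightarrow>\<^sub>E UNIV.
        (\<forall>i<k. p i \<le> x i \<and> x i \<le> q i \<and> p i \<le> y i \<and> y i \<le> q i \<and> x i + y i = p i + q i)
          \<longrightarrow> f x + f y \<le> f p + f q)"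

definition counts :: "('w \<Rightarrow> (real ^ 'd) measure) \<Rightarrow> nat \<Rightarrow> (nat \<Rightarrow> (real ^ 'd) set) \<Rightarrow> 'w \<Rightarrow> nat \<Rightarrow> real" where
  "counts \<Phi> k B \<omega> = (\<lambda>i\<in>{..<k}. measure (\<Phi> \<omega>) (B i))"

definition dcx_le ::
  "'w1 measure \<Rightarrow> ('w1 \<Rightarrow> (real ^ 'd) measure) \<Rightarrow> 'w2 measure \<Rightarrow> ('w2 \<Rightarrow> (real ^ 'd) measure) \<Rightarrow> bool" where
  "dcx_le M1 \<Phi>1 M2 \<Phi>2 \<longleftrightarrow>
     (\<forall>k\<ge>1. \<forall>B f. (\<forall>i<k. bounded_borel (B i)) \<longrightarrow> dcx k f \<longrightarrow>
        integrable M1 (\<lambda>\<omega>. f (counts \<Phi>1 k B \<omega>)) \<longrightarrow>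
        integrable M2 (\<lambda>\<omega>. f (counts \<Phi>2 k B \<omega>)) \<longrightarrow>
        (\<integral>\<omega>. f (counts \<Phi>1 k B \<omega>) \<partial>M1) \<le> (\<integral>\<omega>. f (counts \<Phi>2 k B \<omega>) \<partial>M2))"


section \<open>Boolean models\<close>

definition random_closed_set :: "'v measure \<Rightarrow> ('v \<Rightarrow> (real ^ 'd) set) \<Rightarrow> bool" where
  "random_closed_set N G \<longleftrightarrow>
     prob_space N \<and>
     (\<forall>v\<in>space N. closed (G v)) \<and>
     (\<forall>K. compact K \<longrightarrow> {v \<in> space N. G v \<inter> K \<noteq> {}} \<in> sets N)"

text \<open>
  A measurable enumeration of the points of \<open>\<Phi>\<close>, with multiplicities: \<open>X i \<omega>\<close>, for
  \<open>i < \<kappa> \<omega>\<close>, where \<open>\<kappa> \<omega> \<le> \<infinity>\<close> is the total number of points. The values \<open>X i \<omega>\<close> with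
  \<open>i \<ge> \<kappa> \<omega>\<close> are irrelevant.
\<close>

definition enumerates ::
  "'w measure \<Rightarrow> ('w \<Rightarrow> (real ^ 'd) measure) \<Rightarrow> ('w \<Rightarrow> enat) \<Rightarrow> (nat \<Rightarrow> 'w \<Rightarrow> real ^ 'd) \<Rightarrow> bool" where
  "enumerates M \<Phi> \<kappa> X \<longleftrightarrow>
     \<kappa> \<in> measurable M (count_space UNIV) \<and>
     (\<forall>i. X i \<in> borel_measurable M) \<and>
     (\<forall>\<omega>\<in>space M. \<forall>B\<in>sets borel.
        emeasure (\<Phi> \<omega>) B = emeasure (count_space UNIV) {i. enat i < \<kappa> \<omega> \<and> X i \<omega> \<in> B})"

text \<open>
  The Boolean model lives on \<open>M \<Otimes>\<^sub>M N\<^sup>\<nat>\<close>: the grain attached to the \<open>i\<close>-th germ is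
  \<open>G (v i)\<close>, so that given the germs the grains are i.i.d. copies of \<open>G\<close>.
\<close>

definition germ_grain_space :: "'w measure \<Rightarrow> 'v measure \<Rightarrow> ('w \<times> (nat \<Rightarrow> 'v)) measure" where
  "germ_grain_space M N = M \<Otimes>\<^sub>M Pi\<^sub>M UNIV (\<lambda>_::nat. N)"

definition boolean_set ::
  "('w \<Rightarrow> enat) \<Rightarrow> (nat \<Rightarrow> 'w \<Rightarrow> real ^ 'd) \<Rightarrow> ('v \<Rightarrow> (real ^ 'd) set) \<Rightarrow> 'w \<times> (nat \<Rightarrow> 'v) \<Rightarrow> (real ^ 'd) set" where
  "boolean_set \<kappa> X G = (\<lambda>(\<omega>, v). \<Union>i\<in>{i. enat i < \<kappa> \<omega>}. (+) (X i \<omega>) ` G (v i))"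

definition boolean_model ::
  "'w measure \<Rightarrow> ('w \<Rightarrow> (real ^ 'd) measure) \<Rightarrow> ('w \<Rightarrow> enat) \<Rightarrow> (nat \<Rightarrow> 'w \<Rightarrow> real ^ 'd)
     \<Rightarrow> 'v measure \<Rightarrow> ('v \<Rightarrow> (real ^ 'd) set) \<Rightarrow> bool" where
  "boolean_model M \<Phi> \<kappa> X N G \<longleftrightarrow>
     point_process M \<Phi> \<and> enumerates M \<Phi> \<kappa> X \<and> random_closed_set N G \<and>
     (\<forall>K. compact K \<longrightarrow>
        (\<integral>\<^sup>+(\<omega>, v). emeasure (count_space UNIV)
            {i. enat i < \<kappa> \<omega> \<and> (+) (X i \<omega>) ` G (v i) \<inter> K \<noteq> {}} \<partial>germ_grain_space M N) < \<infinity>)"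

definition fatten :: "real \<Rightarrow> (real ^ 'd) set \<Rightarrow> (real ^ 'd) set" where
  "fatten r A = (\<Union>x\<in>A. cball x r)"


section \<open>Contours in the close-packed lattice\<close>

definition lattice_vertices :: "nat \<Rightarrow> (real ^ 'd) set" where
  "lattice_vertices n = {z. \<forall>i. \<exists>m::int. z $ i = of_int m / real n}"

text \<open>The half-open cube \<open>z + (-h, h]\<^sup>d\<close>.\<close>

definition cube :: "real \<Rightarrow> real ^ 'd \<Rightarrow> (real ^ 'd) set" where
  "cube h z = {x. \<forall>i. z $ i - h < x $ i \<and> x $ i \<le> z $ i + h}"

definition adjacent :: "nat \<Rightarrow> real ^ 'd \<Rightarrow> real ^ 'd \<Rightarrow> bool" where
  "adjacent n z z' \<longleftrightarrow> z \<noteq> z' \<and> cube (1 / real n) z \<inter> cube (1 / real n) z' \<noteq> {}"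

definition infinite_path :: "nat \<Rightarrow> (nat \<Rightarrow> real ^ 'd) \<Rightarrow> bool" where
  "infinite_path n p \<longleftrightarrow>
     p 0 = 0 \<and> inj p \<and> range p \<subseteq> lattice_vertices n \<and> (\<forall>k. adjacent n (p k) (p (Suc k)))"

definition blocks :: "nat \<Rightarrow> (real ^ 'd) set \<Rightarrow> bool" where
  "blocks n \<gamma> \<longleftrightarrow> (\<forall>p. infinite_path n p \<longrightarrow> range p \<inter> \<gamma> \<noteq> {})"

definition contours :: "nat \<Rightarrow> (real ^ 'd) set set" where
  "contours n = {\<gamma>. \<gamma> \<subseteq> lattice_vertices n \<and> blocks n \<gamma> \<and> (\<forall>\<gamma>'. \<gamma>' \<subset> \<gamma> \<longrightarrow> \<not> blocks n \<gamma>')}"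

definition Q_set :: "nat \<Rightarrow> (real ^ 'd) set \<Rightarrow> (real ^ 'd) set" where
  "Q_set n \<gamma> = (\<Union>z\<in>\<gamma>. cube (1 / (2 * real n)) z)"


section \<open>The critical radius\<close>

text \<open>The infimum of the empty set is \<open>\<infinity>\<close> in \<^typ>\<open>ereal\<close>.\<close>

definition upper_critical_radius ::
  "'w measure \<Rightarrow> ('w \<Rightarrow> enat) \<Rightarrow> (nat \<Rightarrow> 'w \<Rightarrow> real ^ 'd) \<Rightarrow> 'v measure \<Rightarrow> ('v \<Rightarrow> (real ^ 'd) set) \<Rightarrow> ereal" where
  "upper_critical_radius M \<kappa> X N G =
     Inf {ereal r | r. 0 < r \<and>
       (\<forall>n\<ge>1. (\<Sum>\<^sub>\<infinity>\<gamma>\<in>contours n.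
          emeasure (germ_grain_space M N)
            {\<xi> \<in> space (germ_grain_space M N).
               boolean_set \<kappa> X (\<lambda>v. fatten r (G v)) \<xi> \<inter> Q_set n \<gamma> = {}}) < \<infinity>)}"

end

theory Submission
  imports Defs
begin

text \<open>
  Conditioning on the germs, the probability that the Boolean model misses \<open>Q\<close> is
  \<open>E \<Prod>\<^bsub>i\<^esub> q (X\<^bsub>i\<^esub>)\<close>, where \<open>q x\<close> is the probability that a grain attached to \<open>x\<close> misses \<open>Q\<close>.
  Approximating \<open>q\<close> from above by step functions \<open>exp (\<Sum>\<^bsub>j\<^esub> c\<^bsub>j\<^esub> 1\<^bsub>B\<^bsub>j\<^esub>\<^esub>)\<close> with \<open>c\<^bsub>j\<^esub> \<le> 0\<close> turns the product into
  \<open>exp (\<Sum>\<^bsub>j\<^esub> c\<^bsub>j\<^esub> \<Phi>(B\<^bsub>j\<^esub>))\<close>, a bounded \<open>dcx\<close> function of the counts. For a deterministic grain \<open>q\<close> takes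
  the values \<open>0\<close> and \<open>1\<close> only, and the expectation is a limit of void probabilities of bounded sets.
  So every summand in the definition of the critical radius is monotone in the germ process.
\<close>

section \<open>Measurability of the hitting events\<close>

lemma fatten_altdef: "fatten r A = {y. \<exists>x\<in>A. dist x y \<le> r}"
  by (auto simp: fatten_def)

text \<open>The fattening is the Minkowski sum with a closed ball, and a sum of two compact sets is
  compact. Enlarged test sets thus remain test sets for a random closed set.\<close>

lemma compact_fatten:
  fixes K :: "(real ^ 'd) set"
  assumes "compact K"
  shows "compact (fatten r K)"
proof -
  have "fatten r K = {x + y |x y. x \<in> K \<and> y \<in> cball 0 r}"
  proof (intro equalityI subsetI)
    fix y assume "y \<in> fatten r K"
    then obtain x where "x \<in> K" "dist x y \<le> r"
      by (auto simp: fatten_altdef)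
    then have "y = x + (y - x)" "y - x \<in> cball 0 r"
      by (auto simp: dist_norm norm_minus_commute)
    with \<open>x \<in> K\<close> show "y \<in> {x + y |x y. x \<in> K \<and> y \<in> cball 0 r}"
      by blast
  qed (force simp: fatten_altdef dist_norm)
  then show ?thesis
    using compact_sums[OF assms compact_cball[of 0 r]] by (simp only:)
qed

text \<open>Symmetry of the distance lets the fattening pass from the grain to the test set. All
  events about fattened grains thereby reduce to hitting events of \<open>G\<close> itself.\<close>

lemma translate_fatten_hits_iff:
  "(+) x ` fatten r A \<inter> K \<noteq> {} \<longleftrightarrow> (+) x ` A \<inter> fatten r K \<noteq> {}"
proof -
  have "(+) x ` fatten r A \<inter> K \<noteq> {} \<longleftrightarrow> (\<exists>a\<in>A. \<exists>y\<in>K. dist a (y - x) \<le> r)"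
  proof
    assume "\<exists>a\<in>A. \<exists>y\<in>K. dist a (y - x) \<le> r"
    then obtain a y where "a \<in> A" "y \<in> K" "dist a (y - x) \<le> r"
      by blast
    then have "y - x \<in> fatten r A"
      by (auto simp: fatten_altdef)
    then have "y \<in> (+) x ` fatten r A"
      by (intro image_eqI[of _ _ "y - x"]) auto
    with \<open>y \<in> K\<close> show "(+) x ` fatten r A \<inter> K \<noteq> {}"
      by blast
  qed (force simp: fatten_altdef)
  moreover have "(+) x ` A \<inter> fatten r K \<noteq> {} \<longleftrightarrow> (\<exists>a\<in>A. \<exists>y\<in>K. dist y (x + a) \<le> r)"
    by (auto simp: fatten_altdef)
  moreover have "dist a (y - x) = dist y (x + a)" for a y
    by (simp add: dist_norm norm_minus_commute algebra_simps)
  ultimately show ?thesis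
    by simp
qed

text \<open>
  Joint measurability of hitting a moving compact set: replace \<open>x\<close> by a nearby point of a
  countable dense set and enlarge \<open>K\<close> accordingly.
\<close>

lemma sets_translate_hits:
  fixes G :: "'v \<Rightarrow> (real ^ 'd) set"
  assumes G: "random_closed_set N G" and K: "compact K"
  shows "{p \<in> space (borel \<Otimes>\<^sub>M N). (+) (fst p) ` G (snd p) \<inter> K \<noteq> {}} \<in> sets (borel \<Otimes>\<^sub>M N)"
proof -
  obtain D :: "(real ^ 'd) set" where D: "countable D"
    and dense: "\<And>X. open X \<Longrightarrow> X \<noteq> {} \<Longrightarrow> \<exists>d\<in>D. d \<in> X"
    by (rule countable_dense_setE) blast
  \<comment> \<open>The germ location is frozen at \<open>q\<close>; the slack
    \<open>1 / real (Suc n)\<close> absorbs the distance from \<open>q\<close> to the true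
    location.\<close>
  define E where "E n q = {v \<in> space N. G v \<inter> fatten (1 / real (Suc n)) ((\<lambda>y. y - q) ` K) \<noteq> {}}" for n q
  have E: "E n q \<in> sets N" for n q
  proof -
    have "compact (fatten (1 / real (Suc n)) ((\<lambda>y. y - q) ` K))"
      by (intro compact_fatten compact_continuous_image K continuous_intros)
    then show ?thesis
      using G by (simp add: random_closed_set_def E_def)
  qed
  have "{p \<in> space (borel \<Otimes>\<^sub>M N). (+) (fst p) ` G (snd p) \<inter> K \<noteq> {}} =
      (\<Inter>n. \<Union>q\<in>D. ball q (1 / real (Suc n)) \<times> E n q)"
  proof (intro equalityI subsetI)
    fix p assume "p \<in> {p \<in> space (borel \<Otimes>\<^sub>M N). (+) (fst p) ` G (snd p) \<inter> K \<noteq> {}}"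
    then obtain x v y where p: "p = (x, v)" "v \<in> space N" "y \<in> G v" "x + y \<in> K"
      by (cases p) (auto simp: space_pair_measure)
    have "\<exists>q\<in>D. p \<in> ball q (1 / real (Suc n)) \<times> E n q" for n
    proof -
      obtain q where q: "q \<in> D" "q \<in> ball x (1 / real (Suc n))"
        using dense[of "ball x (1 / real (Suc n))"] by auto
      have "dist (x + y - q) y \<le> 1 / real (Suc n)"
        using q(2) by (simp add: dist_norm algebra_simps)
      then have "y \<in> fatten (1 / real (Suc n)) ((\<lambda>y. y - q) ` K)"
        using p(4) unfolding fatten_altdef by blast
      then have "v \<in> E n q"
        using p by (auto simp: E_def)
      then show ?thesis
        using p q by (auto simp: dist_commute)
    qed
    then show "p \<in> (\<Inter>n. \<Union>q\<in>D. ball q (1 / real (Suc n)) \<times> E n q)"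
      by blast
  next
    fix p assume "p \<in> (\<Inter>n. \<Union>q\<in>D. ball q (1 / real (Suc n)) \<times> E n q)"
    moreover obtain x v where p: "p = (x, v)"
      by (cases p)
    ultimately have *: "\<exists>q. dist q x < 1 / real (Suc n) \<and> v \<in> E n q" for n
      by fastforce
    then have v: "v \<in> space N"
      by (auto simp: E_def)
    \<comment> \<open>Replacing \<open>x\<close> by \<open>q\<close> and fattening \<open>K\<close>
      each cost at most \<open>1 / real (Suc n)\<close>, hence the factor 2.\<close>
    have close: "\<exists>g\<in>G v. \<exists>y\<in>K. dist (x + g) y < 2 / real (Suc n)" for n
    proof -
      obtain q g y where "dist q x < 1 / real (Suc n)" "g \<in> G v" "y \<in> K"
          "dist (y - q) g \<le> 1 / real (Suc n)"
        using *[of n] unfolding E_def fatten_altdef by blast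
      moreover have "dist (x + g) y \<le> dist q x + dist (y - q) g"
        using norm_triangle_ineq[of "x - q" "g - (y - q)"]
        by (simp add: dist_norm algebra_simps norm_minus_commute)
      ultimately show ?thesis
        by (intro bexI[of _ g] bexI[of _ y]) auto
    qed
    \<comment> \<open>Closedness of the grain enters here: a closed set disjoint from a compact one
      stays at a positive distance from it, against \<open>close\<close> for large
      \<open>n\<close>.\<close>
    have "(+) x ` G v \<inter> K \<noteq> {}"
    proof
      assume "(+) x ` G v \<inter> K = {}"
      moreover have "closed ((+) x ` G v)"
        using G v by (intro closed_translation) (auto simp: random_closed_set_def)
      ultimately obtain d where d: "d > 0" "\<forall>a\<in>K. \<forall>b\<in>(+) x ` G v. d \<le> dist a b"
        using separate_compact_closed[OF K] by blast
      obtain n where "2 / real (Suc n) < d"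
        using reals_Archimedean[of "d / 2"] d(1) by (auto simp: field_simps)
      with close[of n] d(2) show False
        by (force simp: dist_commute)
    qed
    with p v show "p \<in> {p \<in> space (borel \<Otimes>\<^sub>M N). (+) (fst p) ` G (snd p) \<inter> K \<noteq> {}}"
      by (auto simp: space_pair_measure)
  qed
  moreover have "\<dots> \<in> sets (borel \<Otimes>\<^sub>M N)"
    using D E by (intro sets.countable_INT' sets.countable_UN' pair_measureI) auto
  ultimately show ?thesis
    by simp
qed

text \<open>Missing a countable union is the complement of countably many hitting events, each with
  the fattening moved onto the compact set.\<close>

lemma sets_translate_fatten_misses:
  fixes G :: "'v \<Rightarrow> (real ^ 'd) set"
  assumes "random_closed_set N G" and "countable \<K>" and "\<And>K. K \<in> \<K> \<Longrightarrow> compact K"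
  shows "{p \<in> space (borel \<Otimes>\<^sub>M N). (+) (fst p) ` fatten r (G (snd p)) \<inter> \<Union>\<K> = {}} \<in> sets (borel \<Otimes>\<^sub>M N)"
proof -
  let ?H = "\<lambda>K. {p \<in> space (borel \<Otimes>\<^sub>M N). (+) (fst p) ` G (snd p) \<inter> fatten r K \<noteq> {}}"
  have "{p \<in> space (borel \<Otimes>\<^sub>M N). (+) (fst p) ` fatten r (G (snd p)) \<inter> \<Union>\<K> = {}} =
      space (borel \<Otimes>\<^sub>M N) - (\<Union>K\<in>\<K>. ?H K)"
    unfolding translate_fatten_hits_iff[symmetric] by blast
  moreover have "?H K \<in> sets (borel \<Otimes>\<^sub>M N)" if "K \<in> \<K>" for K
    using assms that by (intro sets_translate_hits compact_fatten)
  ultimately show ?thesis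
    using assms(2) by (auto intro!: sets.Diff sets.countable_UN')
qed

section \<open>Half-open cubes and contours as countable unions of compact sets\<close>

text \<open>A half-open cube is not closed on its lower faces; pulling these inwards by
  \<open>1 / real (Suc m)\<close> exhausts it by compact boxes.\<close>

lemma cube_eq_Union_cbox:
  "cube h z = (\<Union>m. cbox (\<chi> i. z $ i - h + 1 / real (Suc m)) (\<chi> i. z $ i + h))"
proof (intro equalityI subsetI)
  fix x assume x: "x \<in> cube h z"
  \<comment> \<open>One \<open>m\<close> serves all coordinates because there are finitely many of
    them.\<close>
  have "eventually (\<lambda>m. \<forall>i. z $ i - h + 1 / real (Suc m) < x $ i) sequentially"
  proof (rule eventually_all_finite)
    fix i
    have "(\<lambda>m. z $ i - h + 1 / real (Suc m)) \<longlonglongrightarrow> z $ i - h + 0"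
      by (intro tendsto_intros LIMSEQ_Suc[OF lim_1_over_n])
    then show "eventually (\<lambda>m. z $ i - h + 1 / real (Suc m) < x $ i) sequentially"
      using x by (intro order_tendstoD(2)) (auto simp: cube_def)
  qed
  then obtain m where "\<forall>i. z $ i - h + 1 / real (Suc m) < x $ i"
    by (auto simp: eventually_sequentially)
  then show "x \<in> (\<Union>m. cbox (\<chi> i. z $ i - h + 1 / real (Suc m)) (\<chi> i. z $ i + h))"
    using x by (auto simp: cube_def mem_box_cart intro!: exI[of _ m] less_imp_le)
next
  fix x assume "x \<in> (\<Union>m. cbox (\<chi> i. z $ i - h + 1 / real (Suc m)) (\<chi> i. z $ i + h))"
  then obtain m where "\<forall>i. z $ i - h + 1 / real (Suc m) \<le> x $ i \<and> x $ i \<le> z $ i + h"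
    by (auto simp: mem_box_cart)
  moreover have "z $ i - h < z $ i - h + 1 / real (Suc m)" for i
    by simp
  ultimately show "x \<in> cube h z"
    unfolding cube_def by (blast intro: less_le_trans)
qed

lemma countable_lattice_vertices: "countable (lattice_vertices n :: (real ^ 'd) set)"
proof -
  have "z \<in> range (\<lambda>f :: 'd \<Rightarrow> int. \<chi> i. of_int (f i) / real n)"
    if "z \<in> lattice_vertices n" for z :: "real ^ 'd"
  proof -
    from that obtain f :: "'d \<Rightarrow> int" where "\<And>i. z $ i = of_int (f i) / real n"
      unfolding lattice_vertices_def mem_Collect_eq by metis
    then show ?thesis
      by (intro image_eqI[of _ _ f]) (auto simp: vec_eq_iff)
  qed
  then have "lattice_vertices n \<subseteq> range (\<lambda>f :: 'd \<Rightarrow> int. \<chi> i. of_int (f i) / real n)"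
    by blast
  then show ?thesis
    using countable_subset by fastforce
qed

text \<open>A contour is countable as a set of lattice vertices, which suffices to reach its cubes
  through hitting events of compact sets.\<close>

lemma Q_set_sigma_compact:
  assumes "\<gamma> \<in> contours n"
  obtains \<K> :: "(real ^ 'd) set set"
    where "countable \<K>" "\<And>K. K \<in> \<K> \<Longrightarrow> compact K" "Q_set n \<gamma> = \<Union>\<K>"
proof -
  let ?B = "\<lambda>z m. cbox (\<chi> i. z $ i - 1 / (2 * real n) + 1 / real (Suc m)) (\<chi> i. z $ i + 1 / (2 * real n)) :: (real ^ 'd) set"
  have "countable \<gamma>"
    using assms countable_lattice_vertices countable_subset by (fastforce simp: contours_def)
  then have "countable (\<Union>z\<in>\<gamma>. range (?B z))"
    by simp
  moreover have "Q_set n \<gamma> = \<Union>(\<Union>z\<in>\<gamma>. range (?B z))"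
    unfolding Q_set_def cube_eq_Union_cbox by blast
  moreover have "compact K" if "K \<in> (\<Union>z\<in>\<gamma>. range (?B z))" for K
    using that by auto
  ultimately show thesis
    by (intro that[of "\<Union>z\<in>\<gamma>. range (?B z)"])
qed

section \<open>Generating functionals\<close>

text \<open>
  The expectation of \<open>retention \<kappa> X g n\<close> converges to the generating functional
  \<open>E \<Prod>\<^bsub>i < \<kappa>\<^esub> g (X i)\<close> of the point process; the truncation avoids infinite products.
\<close>

definition retention ::
  "('w \<Rightarrow> enat) \<Rightarrow> (nat \<Rightarrow> 'w \<Rightarrow> 'a) \<Rightarrow> ('a \<Rightarrow> real) \<Rightarrow> nat \<Rightarrow> 'w \<Rightarrow> real" where
  "retention \<kappa> X g n \<omega> = (\<Prod>i<n. if enat i < \<kappa> \<omega> then g (X i \<omega>) else 1)"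

locale germs = prob_space M for M :: "'w measure" +
  fixes \<kappa> :: "'w \<Rightarrow> enat" and X :: "nat \<Rightarrow> 'w \<Rightarrow> real ^ 'd"
  assumes count_measurable [measurable]: "\<kappa> \<in> measurable M (count_space UNIV)"
    and germ_measurable [measurable]: "\<And>i. X i \<in> borel_measurable M"
begin

lemma retention_measurable [measurable]:
  assumes [measurable]: "g \<in> borel_measurable borel"
  shows "retention \<kappa> X g n \<in> borel_measurable M"
  unfolding retention_def by measurable

lemma retention_bounds:
  assumes "\<And>x. 0 \<le> g x" "\<And>x. g x \<le> 1"
  shows "0 \<le> retention \<kappa> X g n \<omega>" "retention \<kappa> X g n \<omega> \<le> 1"
  unfolding retention_def using assms by (auto intro!: prod_nonneg prod_le_1)

lemma retention_mono:
  assumes "\<And>x. 0 \<le> g x" "\<And>x. g x \<le> h x"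
  shows "retention \<kappa> X g n \<omega> \<le> retention \<kappa> X h n \<omega>"
  unfolding retention_def using assms by (auto intro!: prod_mono)

lemma decseq_retention:
  assumes "\<And>x. 0 \<le> g x" "\<And>x. g x \<le> 1"
  shows "decseq (\<lambda>n. retention \<kappa> X g n \<omega>)"
proof (rule decseq_SucI)
  fix n
  show "retention \<kappa> X g (Suc n) \<omega> \<le> retention \<kappa> X g n \<omega>"
    using retention_bounds(1)[of g n \<omega>] assms by (simp add: retention_def mult_left_le)
qed

lemma integrable_retention:
  assumes [measurable]: "g \<in> borel_measurable borel" and "\<And>x. 0 \<le> g x" "\<And>x. g x \<le> 1"
  shows "integrable M (retention \<kappa> X g n)"
  using retention_bounds[of g] assms by (intro integrable_const_bound[of _ 1]) auto

lemma decseq_integral_retention: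
  assumes "g \<in> borel_measurable borel" "\<And>x. 0 \<le> g x" "\<And>x. g x \<le> 1"
  shows "decseq (\<lambda>n. \<integral>\<omega>. retention \<kappa> X g n \<omega> \<partial>M)"
  unfolding decseq_def using decseq_retention[of g] assms
  by (auto intro!: integral_mono integrable_retention simp: decseq_def)

lemma tendsto_integral_retention:
  assumes [measurable]: "g \<in> borel_measurable borel" and "\<And>x. 0 \<le> g x" "\<And>x. g x \<le> 1"
    and F [measurable]: "F \<in> borel_measurable M"
    and "\<And>\<omega>. \<omega> \<in> space M \<Longrightarrow> (\<lambda>n. retention \<kappa> X g n \<omega>) \<longlonglongrightarrow> F \<omega>"
  shows "(\<lambda>n. \<integral>\<omega>. retention \<kappa> X g n \<omega> \<partial>M) \<longlonglongrightarrow> (\<integral>\<omega>. F \<omega> \<partial>M)"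
proof (rule integral_dominated_convergence[where w = "\<lambda>_. 1"])
  show "AE \<omega> in M. (\<lambda>n. retention \<kappa> X g n \<omega>) \<longlonglongrightarrow> F \<omega>"
    by (intro AE_I2 assms(5))
  show "AE \<omega> in M. norm (retention \<kappa> X g n \<omega>) \<le> 1" for n
    using retention_bounds[of g, OF assms(2,3)] by simp
qed auto

text \<open>Here the grains are arbitrary marks and \<open>H\<close> says which marked germs are harmless.\<close>

lemma tendsto_integral_retention_iid:
  assumes N: "prob_space N" and H: "H \<in> sets (borel \<Otimes>\<^sub>M N)"
  shows "(\<lambda>n. \<integral>\<omega>. retention \<kappa> X (\<lambda>x. measure N (Pair x -` H)) n \<omega> \<partial>M) \<longlonglongrightarrow>
    measure (germ_grain_space M N)
      {\<xi> \<in> space (germ_grain_space M N). \<forall>i. enat i < \<kappa> (fst \<xi>) \<longrightarrow> (X i (fst \<xi>), snd \<xi> i) \<in> H}"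
proof -
  interpret N: prob_space N by (rule N)
  interpret P: product_prob_space "\<lambda>_::nat. N" UNIV
    by unfold_locales
  interpret MP: pair_prob_space M "Pi\<^sub>M UNIV (\<lambda>_::nat. N)"
    by unfold_locales
  let ?S = "germ_grain_space M N"
  interpret S: prob_space ?S
    unfolding germ_grain_space_def by unfold_locales
  define q where "q x = measure N (Pair x -` H)" for x
  have q: "q \<in> borel_measurable borel"
    unfolding q_def using N.measurable_emeasure_Pair[OF H] by (simp add: measure_def)
  have sec: "Pair x -` H \<in> sets N" for x
    using H by (rule sets_Pair1)
  \<comment> \<open>Truncation to the first \<open>n\<close> indices, so that only finitely many
    grains are involved.\<close>
  define A where "A n = {\<xi> \<in> space ?S. \<forall>i<n. enat i < \<kappa> (fst \<xi>) \<longrightarrow> (X i (fst \<xi>), snd \<xi> i) \<in> H}" for n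
  have [measurable]: "{p \<in> space ?S. (X i (fst p), snd p i) \<in> H} \<in> sets ?S" for i
  proof -
    have "(\<lambda>p. (X i (fst p), snd p i)) \<in> measurable ?S (borel \<Otimes>\<^sub>M N)"
      unfolding germ_grain_space_def by measurable
    from measurable_sets[OF this H] show ?thesis
      by (simp add: vimage_def Int_def conj_commute)
  qed
  have [measurable]: "{p \<in> space ?S. enat i < \<kappa> (fst p)} \<in> sets ?S" for i
    unfolding germ_grain_space_def by measurable
  have A: "A n \<in> sets ?S" for n
    unfolding A_def by (intro sets.sets_Collect_finite_All' sets.sets_Collect) auto
  have "measure ?S (A n) = (\<integral>\<omega>. retention \<kappa> X q n \<omega> \<partial>M)" for n
  proof -
    \<comment> \<open>Tonelli: with the germs frozen, the grains are integrated out first.\<close>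
    have "emeasure ?S (A n) = (\<integral>\<^sup>+\<omega>. emeasure (Pi\<^sub>M UNIV (\<lambda>_. N)) (Pair \<omega> -` A n) \<partial>M)"
      using A[of n] unfolding germ_grain_space_def by (rule P.emeasure_pair_measure_alt)
    also have "\<dots> = (\<integral>\<^sup>+\<omega>. ennreal (retention \<kappa> X q n \<omega>) \<partial>M)"
    proof (rule nn_integral_cong)
      fix \<omega> assume \<omega>: "\<omega> \<in> space M"
      \<comment> \<open>Indices beyond \<open>\<kappa> \<omega>\<close> impose no condition; their
        factor is the total mass 1, matching the default value in \<open>retention\<close>.\<close>
      let ?A = "\<lambda>i. if enat i < \<kappa> \<omega> then Pair (X i \<omega>) -` H else space N"
      have "Pair \<omega> -` A n = {v \<in> space (Pi\<^sub>M UNIV (\<lambda>_. N)). \<forall>i\<in>{..<n}. v i \<in> ?A i}"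
        using \<omega> by (auto simp: A_def germ_grain_space_def space_pair_measure space_PiM PiE_iff)
      moreover have "emeasure (Pi\<^sub>M UNIV (\<lambda>_. N)) {v \<in> space (Pi\<^sub>M UNIV (\<lambda>_. N)). \<forall>i\<in>{..<n}. v i \<in> ?A i} =
          (\<Prod>i<n. emeasure N (?A i))"
        by (intro P.emeasure_PiM_Collect) (auto simp: sec)
      ultimately have "emeasure (Pi\<^sub>M UNIV (\<lambda>_. N)) (Pair \<omega> -` A n) = (\<Prod>i<n. emeasure N (?A i))"
        by (simp only:)
      also have "\<dots> = (\<Prod>i<n. ennreal (if enat i < \<kappa> \<omega> then q (X i \<omega>) else 1))"
        by (intro prod.cong) (auto simp: q_def N.emeasure_eq_measure N.prob_space)
      also have "\<dots> = ennreal (retention \<kappa> X q n \<omega>)"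
        unfolding retention_def by (intro prod_ennreal) (auto simp: q_def)
      finally show "emeasure (Pi\<^sub>M UNIV (\<lambda>_. N)) (Pair \<omega> -` A n) = ennreal (retention \<kappa> X q n \<omega>)" .
    qed
    also have "\<dots> = ennreal (\<integral>\<omega>. retention \<kappa> X q n \<omega> \<partial>M)"
      using q by (intro nn_integral_eq_integral integrable_retention AE_I2 retention_bounds)
        (auto simp: q_def)
    finally show ?thesis
      by (simp add: S.emeasure_eq_measure integral_nonneg_AE retention_bounds(1) q_def)
  qed
  \<comment> \<open>Continuity from above removes the truncation.\<close>
  moreover have "(\<lambda>n. measure ?S (A n)) \<longlonglongrightarrow> measure ?S (\<Inter>n. A n)"
    using A by (intro S.finite_Lim_measure_decseq) (auto simp: A_def decseq_def)
  moreover have "(\<Inter>n. A n) =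
      {\<xi> \<in> space ?S. \<forall>i. enat i < \<kappa> (fst \<xi>) \<longrightarrow> (X i (fst \<xi>), snd \<xi> i) \<in> H}"
    by (auto simp: A_def)
  ultimately show ?thesis
    by (simp add: q_def[abs_def])
qed

end

text \<open>
  The truncated products for \<open>g m\<close> decrease to their generating functional and converge, as
  \<open>m\<close> grows, to the ones for \<open>q\<close>; so \<open>g\<close> need not be monotone in \<open>m\<close>.
\<close>

lemma generating_functional_le_approx:
  assumes "germs M1 \<kappa>1 X1" "germs M2 \<kappa>2 X2"
    and q: "q \<in> borel_measurable borel" "\<And>x. 0 \<le> q x"
    and g: "\<And>m. g m \<in> borel_measurable borel" "\<And>m x. q x \<le> g m x" "\<And>m x. g m x \<le> 1"
    and lim: "\<And>x. (\<lambda>m. g m x) \<longlonglongrightarrow> q x"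
    and a1: "(\<lambda>n. \<integral>\<omega>. retention \<kappa>1 X1 q n \<omega> \<partial>M1) \<longlonglongrightarrow> a1"
    and a2: "(\<lambda>n. \<integral>\<omega>. retention \<kappa>2 X2 q n \<omega> \<partial>M2) \<longlonglongrightarrow> a2"
    and b1: "\<And>m. (\<lambda>n. \<integral>\<omega>. retention \<kappa>1 X1 (g m) n \<omega> \<partial>M1) \<longlonglongrightarrow> b1 m"
    and b2: "\<And>m. (\<lambda>n. \<integral>\<omega>. retention \<kappa>2 X2 (g m) n \<omega> \<partial>M2) \<longlonglongrightarrow> b2 m"
    and le: "\<And>m. b1 m \<le> b2 m"
  shows "a1 \<le> a2"
proof -
  interpret M1: germs M1 \<kappa>1 X1 by fact
  interpret M2: germs M2 \<kappa>2 X2 by fact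
  have q1: "q x \<le> 1" and g0: "0 \<le> g m x" for x m
    using g(2,3)[where x = x] q(2)[of x] order_trans by blast+
  \<comment> \<open>The limits are taken one after the other and never exchanged: first
    \<open>m\<close> grows for fixed \<open>n\<close>, then \<open>n\<close> grows.\<close>
  have "a1 \<le> (\<integral>\<omega>. retention \<kappa>2 X2 q n \<omega> \<partial>M2)" for n
  proof (rule LIMSEQ_le_const)
    show "(\<lambda>m. \<integral>\<omega>. retention \<kappa>2 X2 (g m) n \<omega> \<partial>M2) \<longlonglongrightarrow> (\<integral>\<omega>. retention \<kappa>2 X2 q n \<omega> \<partial>M2)"
    proof (rule integral_dominated_convergence[where w = "\<lambda>_. 1"])
      show "AE \<omega> in M2. (\<lambda>m. retention \<kappa>2 X2 (g m) n \<omega>) \<longlonglongrightarrow> retention \<kappa>2 X2 q n \<omega>"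
        unfolding retention_def using lim by (auto intro!: tendsto_prod)
    qed (use q g g0 M2.retention_bounds[of "g _"] in auto)
    have "a1 \<le> (\<integral>\<omega>. retention \<kappa>2 X2 (g m) n \<omega> \<partial>M2)" for m
    proof -
      have "a1 \<le> b1 m"
        using q q1 g g0
        by (intro LIMSEQ_le[OF a1 b1]) (auto intro!: integral_mono M1.integrable_retention M1.retention_mono)
      also have "\<dots> \<le> b2 m" by (rule le)
      \<comment> \<open>Truncated integrals decrease in \<open>n\<close>, so their limit
        \<open>b2 m\<close> lies below each of them.\<close>
      also have "\<dots> \<le> (\<integral>\<omega>. retention \<kappa>2 X2 (g m) n \<omega> \<partial>M2)"
        using g g0 by (intro decseq_ge[OF M2.decseq_integral_retention b2])
      finally show ?thesis .
    qed
    then show "\<exists>k. \<forall>m\<ge>k. a1 \<le> (\<integral>\<omega>. retention \<kappa>2 X2 (g m) n \<omega> \<partial>M2)"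
      by blast
  qed
  then show ?thesis
    by (intro LIMSEQ_le_const[OF a2]) blast
qed

section \<open>The directionally convex order and the void probabilities\<close>

text \<open>Increments of a convex function increase: over the length \<open>a - u\<close>, the
  increment of exp from \<open>b\<close> to \<open>w\<close> is at least the one from
  \<open>u\<close> to \<open>a\<close>.\<close>

lemma exp_add_le:
  fixes a b u w :: real
  assumes "u \<le> a" "u \<le> b" "a + b = u + w"
  shows "exp a + exp b \<le> exp u + exp w"
proof -
  have "exp u * (exp (a - u) - 1) \<le> exp b * (exp (a - u) - 1)"
    using assms by (intro mult_right_mono) auto
  moreover have "b + (a - u) = w" "u + (a - u) = a"
    using assms by auto
  ultimately show ?thesis
    by (simp add: algebra_simps flip: exp_add)
qed

text \<open>With coefficients of one sign the linear form maps the box between \<open>p\<close> and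
  \<open>q\<close> into the interval between its values at these corners; convexity of exp does the
  rest.\<close>

lemma dcx_exp_linear:
  assumes c: "\<And>j. j < k \<Longrightarrow> c j \<le> 0"
  shows "dcx k (\<lambda>x. exp (\<Sum>j<k. c j * x j))"
  unfolding dcx_def
proof (intro conjI ballI impI)
  have "(\<lambda>x. exp (\<Sum>j<k. c j * x j)) \<in> borel_measurable (Pi\<^sub>M {..<k} (\<lambda>_. lborel))"
    by measurable
  then show "(\<lambda>x. exp (\<Sum>j<k. c j * x j)) \<in> borel_measurable (completion (Pi\<^sub>M {..<k} (\<lambda>_. lborel)))"
    by (rule measurable_completion)
next
  fix x y p q :: "nat \<Rightarrow> real"
  assume *: "\<forall>i<k. p i \<le> x i \<and> x i \<le> q i \<and> p i \<le> y i \<and> y i \<le> q i \<and> x i + y i = p i + q i"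
  let ?S = "\<lambda>x. \<Sum>j<k. c j * x j"
  \<comment> \<open>Nonpositive coefficients reverse the order, so \<open>q\<close> supplies the
    smallest exponent.\<close>
  have "?S q \<le> ?S x" "?S q \<le> ?S y"
    using * c by (auto intro!: sum_mono mult_left_mono_neg)
  moreover have "?S x + ?S y = ?S q + ?S p"
    unfolding sum.distrib[symmetric] distrib_left[symmetric]
    using * by (intro sum.cong) (auto simp: add.commute)
  ultimately show "exp (?S x) + exp (?S y) \<le> exp (?S p) + exp (?S q)"
    using exp_add_le by (metis add.commute)
qed

section \<open>Germ counts and products of step functions\<close>

text \<open>Counts of bounded sets are natural numbers, hence not infinite, so only finitely many
  indices can fall into such a set. Counting indices respects multiplicities.\<close>

lemma card_germs_bounded:
  assumes "point_process M \<Phi>" "enumerates M \<Phi> \<kappa> X" "bounded_borel B" "\<omega> \<in> space M"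
  shows "finite {i. enat i < \<kappa> \<omega> \<and> X i \<omega> \<in> B}"
    and "measure (\<Phi> \<omega>) B = real (card {i. enat i < \<kappa> \<omega> \<and> X i \<omega> \<in> B})"
proof -
  have eq: "emeasure (\<Phi> \<omega>) B = emeasure (count_space UNIV) {i. enat i < \<kappa> \<omega> \<and> X i \<omega> \<in> B}"
    using assms by (simp add: enumerates_def)
  moreover have "emeasure (\<Phi> \<omega>) B \<in> \<nat>"
    using assms(1,3,4) unfolding point_process_def by blast
  then have "emeasure (\<Phi> \<omega>) B \<noteq> \<infinity>"
    by (auto elim!: Nats_cases)
  ultimately show fin: "finite {i. enat i < \<kappa> \<omega> \<and> X i \<omega> \<in> B}"
    by (metis emeasure_count_space_infinite infinity_ennreal_def subset_UNIV)
  then show "measure (\<Phi> \<omega>) B = real (card {i. enat i < \<kappa> \<omega> \<and> X i \<omega> \<in> B})"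
    using eq by (simp add: measure_def ennreal_of_nat_eq_real_of_nat)
qed

lemma enumerates_germs:
  assumes "point_process M \<Phi>" "enumerates M \<Phi> \<kappa> X"
  shows "germs M \<kappa> X"
  using assms unfolding germs_def germs_axioms_def
  by (auto simp: point_process_def enumerates_def)

lemma counts_measurable:
  assumes "point_process M \<Phi>" "bounded_borel (B j)" "j < k"
  shows "(\<lambda>\<omega>. counts \<Phi> k B \<omega> j) \<in> borel_measurable M"
  using assms unfolding point_process_def counts_def by (auto simp: measure_def)

text \<open>A product of exponentials is the exponential of a double sum, and swapping the sums
  counts the germs in each \<open>B j\<close>. Each count stabilises once all of its finitely many
  indices are included.\<close>

lemma tendsto_retention_step:
  assumes "point_process M \<Phi>" "enumerates M \<Phi> \<kappa> X" "\<And>j. j < k \<Longrightarrow> bounded_borel (B j)" "\<omega> \<in> space M"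
  shows "(\<lambda>n. retention \<kappa> X (\<lambda>x. exp (\<Sum>j<k. c j * indicator (B j) x)) n \<omega>)
    \<longlonglongrightarrow> exp (\<Sum>j<k. c j * counts \<Phi> k B \<omega> j)"
proof -
  define I where "I j = {i. enat i < \<kappa> \<omega> \<and> X i \<omega> \<in> B j}" for j
  have I: "finite (I j)" "counts \<Phi> k B \<omega> j = real (card (I j))" if "j < k" for j
    using card_germs_bounded[OF assms(1,2) assms(3)[OF that] assms(4)] that
    by (simp_all add: I_def counts_def)
  have "retention \<kappa> X (\<lambda>x. exp (\<Sum>j<k. c j * indicator (B j) x)) n \<omega> =
      exp (\<Sum>j<k. c j * real (card (I j \<inter> {..<n})))" for n
  proof -
    have "retention \<kappa> X (\<lambda>x. exp (\<Sum>j<k. c j * indicator (B j) x)) n \<omega> =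
        (\<Prod>i<n. exp (\<Sum>j<k. c j * indicator (I j) i))"
      unfolding retention_def by (intro prod.cong) (auto simp: I_def indicator_def)
    also have "\<dots> = exp (\<Sum>i<n. \<Sum>j<k. c j * indicator (I j) i)"
      by (rule exp_sum[symmetric]) simp
    also have "(\<Sum>i<n. \<Sum>j<k. c j * indicator (I j) i) = (\<Sum>j<k. \<Sum>i<n. c j * indicator (I j) i)"
      by (rule sum.swap)
    also have "\<dots> = (\<Sum>j<k. c j * real (card (I j \<inter> {..<n})))"
    proof (rule sum.cong[OF refl])
      fix j
      have "(\<Sum>i<n. indicator (I j) i) = real (card (I j \<inter> {..<n}))"
        using sum_mult_indicator[of "{..<n}" "\<lambda>_. 1 :: real" "\<lambda>_. I j" "\<lambda>i. i"]
        by (simp add: Int_def conj_commute)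
      then show "(\<Sum>i<n. c j * indicator (I j) i) = c j * real (card (I j \<inter> {..<n}))"
        by (simp add: sum_distrib_left[symmetric])
    qed
    finally show ?thesis .
  qed
  moreover have "(\<lambda>n. real (card (I j \<inter> {..<n}))) \<longlonglongrightarrow> counts \<Phi> k B \<omega> j" if j: "j < k" for j
  proof (rule tendsto_eventually)
    obtain n0 where "I j \<subseteq> {..<n0}"
      using I(1)[OF j] finite_nat_iff_bounded by blast
    then have "I j \<inter> {..<n} = I j" if "n0 \<le> n" for n
      using that by fastforce
    then show "eventually (\<lambda>n. real (card (I j \<inter> {..<n})) = counts \<Phi> k B \<omega> j) sequentially"
      using I(2)[OF j] by (auto simp: eventually_sequentially intro!: exI[of _ n0])
  qed
  ultimately show ?thesis
    by (auto intro!: tendsto_intros)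
qed

lemma dcx_le_generating_functional:
  fixes q :: "real ^ 'd \<Rightarrow> real"
  assumes P1: "point_process M1 \<Phi>1" "enumerates M1 \<Phi>1 \<kappa>1 X1"
    and P2: "point_process M2 \<Phi>2" "enumerates M2 \<Phi>2 \<kappa>2 X2"
    and le: "dcx_le M1 \<Phi>1 M2 \<Phi>2"
    and q [measurable]: "q \<in> borel_measurable borel" and q01: "\<And>x. 0 \<le> q x" "\<And>x. q x \<le> 1"
    and a1: "(\<lambda>n. \<integral>\<omega>. retention \<kappa>1 X1 q n \<omega> \<partial>M1) \<longlonglongrightarrow> a1"
    and a2: "(\<lambda>n. \<integral>\<omega>. retention \<kappa>2 X2 q n \<omega> \<partial>M2) \<longlonglongrightarrow> a2"
  shows "a1 \<le> a2"
proof -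
  interpret M1: germs M1 \<kappa>1 X1 by (rule enumerates_germs[OF P1])
  interpret M2: germs M2 \<kappa>2 X2 by (rule enumerates_germs[OF P2])
  \<comment> \<open>Level of \<open>q x\<close> on the grid of mesh \<open>1 / real (Suc m)\<close>,
    rounded down.\<close>
  define t where "t m x = nat \<lfloor>real (Suc m) * q x\<rfloor>" for m x
  \<comment> \<open>Using the upper edge of the level keeps the logarithm away from 0 and the step
    function above \<open>q\<close>. The cap at 1 serves level \<open>m + 1\<close>, attained where
    \<open>q x = 1\<close>, and gives \<open>c m j \<le> 0\<close>.\<close>
  define c where "c m j = ln (min 1 (real (Suc j) / real (Suc m)))" for m j
  \<comment> \<open>The order tests bounded sets only, so level sets are cut off at radius
    \<open>m\<close>; outside that ball \<open>g m\<close> is 1, still an upper bound of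
    \<open>q\<close>.\<close>
  define B where "B m j = {x. norm x \<le> real m \<and> t m x = j}" for m j
  define g where "g m x = exp (\<Sum>j<m + 2. c m j * indicator (B m j) x)" for m x
  have [measurable]: "t m \<in> measurable borel (count_space UNIV)" for m
    unfolding t_def by measurable
  have B: "bounded_borel (B m j)" for m j
  proof
    show "B m j \<in> sets borel"
      unfolding B_def by measurable
    show "bounded (B m j)"
      by (rule bounded_subset[OF bounded_cball[of 0 "real m"]]) (auto simp: B_def)
  qed
  have c: "c m j \<le> 0" for m j
    by (simp add: c_def)
  have t: "t m x < m + 2" "real (t m x) \<le> real (Suc m) * q x" "real (Suc m) * q x \<le> real (t m x) + 1" for m x
  proof -
    have "real (Suc m) * q x \<le> real (Suc m)"
      using q01 by (intro mult_left_le) auto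
    then show "t m x < m + 2"
      unfolding t_def by linarith
    have "0 \<le> real (Suc m) * q x"
      using q01 by simp
    then show "real (t m x) \<le> real (Suc m) * q x" "real (Suc m) * q x \<le> real (t m x) + 1"
      unfolding t_def by linarith+
  qed
  \<comment> \<open>The level sets are disjoint, so inside the ball exactly one summand
    survives.\<close>
  have g: "g m x = (if norm x \<le> real m then min 1 (real (Suc (t m x)) / real (Suc m)) else 1)" for m x
  proof (cases "norm x \<le> real m")
    case True
    have "(\<Sum>j<m + 2. c m j * indicator (B m j) x) = (\<Sum>j<m + 2. if j = t m x then c m j else 0)"
      using True by (intro sum.cong) (auto simp: B_def indicator_def)
    also have "\<dots> = c m (t m x)"
      using t(1)[of m x] by (simp add: sum.delta)
    finally show ?thesis
      using True by (simp add: g_def c_def)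
  qed (simp add: g_def B_def)
  have g_ge: "q x \<le> g m x" for m x
    using t(3)[of m x] q01(2)[of x] by (simp add: g field_simps)
  have g_le: "g m x \<le> q x + 1 / real (Suc m)" if "norm x \<le> real m" for m x
  proof -
    have "real (Suc (t m x)) / real (Suc m) \<le> q x + 1 / real (Suc m)"
      using t(2)[of m x] by (simp only: of_nat_Suc[of "t m x"] add_divide_distrib) (simp add: pos_divide_le_eq mult.commute)
    then show ?thesis
      using that by (simp add: g min.coboundedI2)
  qed
  have gm: "g m \<in> borel_measurable borel" for m
  proof -
    have [measurable]: "B m j \<in> sets borel" for j
      using B by simp
    show ?thesis
      unfolding g_def by measurable
  qed
  have lim: "(\<lambda>m. g m x) \<longlonglongrightarrow> q x" for x
  proof (rule tendsto_sandwich[where f = "\<lambda>_. q x"])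
    show "eventually (\<lambda>m. g m x \<le> q x + 1 / real (Suc m)) sequentially"
      using eventually_ge_at_top[of "nat \<lceil>norm x\<rceil>"] by eventually_elim (rule g_le, linarith)
    have "(\<lambda>m. q x + 1 / real (Suc m)) \<longlonglongrightarrow> q x + 0"
      by (intro tendsto_intros LIMSEQ_Suc[OF lim_1_over_n])
    then show "(\<lambda>m. q x + 1 / real (Suc m)) \<longlonglongrightarrow> q x"
      by simp
  qed (use g_ge in auto)
  have g01: "0 \<le> g m x" "g m x \<le> 1" for m x
    by (simp_all add: g)
  let ?f = "\<lambda>m x. exp (\<Sum>j<m + 2. c m j * x j)"
  \<comment> \<open>Counts are nonnegative, so the test functions are bounded by 1 along the
    processes; this supplies the finite expectations that \<open>dcx_le\<close> asks for.\<close>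
  have f_le: "norm (?f m x) \<le> 1" if "\<And>j. j < m + 2 \<Longrightarrow> 0 \<le> x j" for m x
  proof -
    have "(\<Sum>j<m + 2. c m j * x j) \<le> 0"
      using c that by (intro sum_nonpos mult_nonpos_nonneg) auto
    then show ?thesis
      by (simp only: norm_exp exp_le_one_iff real_norm_def abs_exp_cancel)
  qed
  have fm1: "(\<lambda>\<omega>. ?f m (counts \<Phi>1 (m + 2) (B m) \<omega>)) \<in> borel_measurable M1" for m
    using B by (intro borel_measurable_exp[THEN measurable_compose[rotated]] borel_measurable_sum
        borel_measurable_times borel_measurable_const counts_measurable[OF P1(1)]) auto
  have fm2: "(\<lambda>\<omega>. ?f m (counts \<Phi>2 (m + 2) (B m) \<omega>)) \<in> borel_measurable M2" for m
    using B by (intro borel_measurable_exp[THEN measurable_compose[rotated]] borel_measurable_sum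
        borel_measurable_times borel_measurable_const counts_measurable[OF P2(1)]) auto
  show ?thesis
  proof (rule generating_functional_le_approx[OF M1.germs_axioms M2.germs_axioms q q01(1) gm g_ge g01(2) lim a1 a2])
    show "(\<lambda>n. \<integral>\<omega>. retention \<kappa>1 X1 (g m) n \<omega> \<partial>M1) \<longlonglongrightarrow> (\<integral>\<omega>. ?f m (counts \<Phi>1 (m + 2) (B m) \<omega>) \<partial>M1)" for m
      unfolding g_def[abs_def]
      by (rule M1.tendsto_integral_retention[OF gm[unfolded g_def[abs_def]] _ _ fm1 tendsto_retention_step[OF P1 B]])
        (use g01 in \<open>simp_all only: g_def[symmetric]\<close>)
    show "(\<lambda>n. \<integral>\<omega>. retention \<kappa>2 X2 (g m) n \<omega> \<partial>M2) \<longlonglongrightarrow> (\<integral>\<omega>. ?f m (counts \<Phi>2 (m + 2) (B m) \<omega>) \<partial>M2)" for m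
      unfolding g_def[abs_def]
      by (rule M2.tendsto_integral_retention[OF gm[unfolded g_def[abs_def]] _ _ fm2 tendsto_retention_step[OF P2 B]])
        (use g01 in \<open>simp_all only: g_def[symmetric]\<close>)
    show "(\<integral>\<omega>. ?f m (counts \<Phi>1 (m + 2) (B m) \<omega>) \<partial>M1) \<le> (\<integral>\<omega>. ?f m (counts \<Phi>2 (m + 2) (B m) \<omega>) \<partial>M2)" for m
    proof -
      have int1: "integrable M1 (\<lambda>\<omega>. ?f m (counts \<Phi>1 (m + 2) (B m) \<omega>))"
        by (intro M1.integrable_const_bound[of _ 1] fm1 AE_I2 f_le) (simp add: counts_def)
      have int2: "integrable M2 (\<lambda>\<omega>. ?f m (counts \<Phi>2 (m + 2) (B m) \<omega>))"
        by (intro M2.integrable_const_bound[of _ 1] fm2 AE_I2 f_le) (simp add: counts_def)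
      have "dcx (m + 2) (?f m)"
        by (rule dcx_exp_linear) (rule c)
      from le[unfolded dcx_le_def, rule_format, OF _ B[of m] this int1 int2] show ?thesis
        by simp
    qed
  qed
qed

section \<open>Void probabilities as generating functionals\<close>

text \<open>Each factor vanishes exactly when its germ lies in \<open>B\<close>, so the truncated
  product is the indicator that none of the first \<open>n\<close> germs does.\<close>

lemma tendsto_retention_void:
  assumes P: "point_process M \<Phi>" "enumerates M \<Phi> \<kappa> X" and B: "bounded_borel B"
  shows "(\<lambda>n. \<integral>\<omega>. retention \<kappa> X (\<lambda>x. 1 - indicator B x) n \<omega> \<partial>M) \<longlonglongrightarrow> void_prob M \<Phi> B"
proof -
  interpret germs M \<kappa> X by (rule enumerates_germs[OF P])
  let ?V = "{\<omega> \<in> space M. emeasure (\<Phi> \<omega>) B = 0}"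
  have [measurable]: "B \<in> sets borel"
    using B by simp
  have "(\<lambda>\<omega>. emeasure (\<Phi> \<omega>) B) \<in> borel_measurable M"
    using P(1) B by (auto simp: point_process_def)
  then have V: "?V \<in> sets M"
    by measurable
  have "(\<lambda>n. retention \<kappa> X (\<lambda>x. 1 - indicator B x) n \<omega>) \<longlonglongrightarrow> indicator ?V \<omega>" if \<omega>: "\<omega> \<in> space M" for \<omega>
  proof (cases "\<exists>i. enat i < \<kappa> \<omega> \<and> X i \<omega> \<in> B")
    case True
    then obtain i where i: "enat i < \<kappa> \<omega>" "X i \<omega> \<in> B"
      by blast
    have zero: "retention \<kappa> X (\<lambda>x. 1 - indicator B x) n \<omega> = 0" if "i < n" for n
      unfolding retention_def using i that by (auto intro!: bexI[of _ i])
    have "eventually (\<lambda>n. retention \<kappa> X (\<lambda>x. 1 - indicator B x) n \<omega> = 0) sequentially"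
      by (rule eventually_mono[OF eventually_gt_at_top[of i]]) (rule zero)
    moreover have "emeasure (count_space UNIV) {i. enat i < \<kappa> \<omega> \<and> X i \<omega> \<in> B} \<noteq> 0"
      using i by (auto simp: emeasure_count_space_eq_0)
    then have "indicator ?V \<omega> = (0 :: real)"
      using P(2) B \<omega> by (simp add: enumerates_def)
    ultimately show ?thesis
      by (simp add: tendsto_eventually)
  next
    case False
    then have "retention \<kappa> X (\<lambda>x. 1 - indicator B x) n \<omega> = 1" for n
      unfolding retention_def by (auto intro!: prod.neutral)
    moreover have "emeasure (count_space UNIV) {i. enat i < \<kappa> \<omega> \<and> X i \<omega> \<in> B} = 0"
      using False by (simp add: emeasure_count_space_eq_0)
    then have "\<omega> \<in> ?V"
      using P(2) B \<omega> by (simp add: enumerates_def)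
    ultimately show ?thesis
      by simp
  qed
  then have "(\<lambda>n. \<integral>\<omega>. retention \<kappa> X (\<lambda>x. 1 - indicator B x) n \<omega> \<partial>M) \<longlonglongrightarrow> (\<integral>\<omega>. indicator ?V \<omega> \<partial>M)"
    using V by (intro tendsto_integral_retention borel_measurable_diff borel_measurable_const
        borel_measurable_indicator \<open>B \<in> sets borel\<close>) (simp_all add: indicator_def)
  then show ?thesis
    using V by (simp add: void_prob_def)
qed

text \<open>For \<open>q\<close> with values 0 and 1 the product only asks whether the zero set of
  \<open>q\<close> is free of germs. Cutting that set off at radius \<open>m\<close> gives bounded
  sets whose void probabilities are comparable.\<close>

lemma void_prob_le_generating_functional:
  fixes q :: "real ^ 'd \<Rightarrow> real"
  assumes P1: "point_process M1 \<Phi>1" "enumerates M1 \<Phi>1 \<kappa>1 X1"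
    and P2: "point_process M2 \<Phi>2" "enumerates M2 \<Phi>2 \<kappa>2 X2"
    and le: "\<And>B. bounded_borel B \<Longrightarrow> void_prob M1 \<Phi>1 B \<le> void_prob M2 \<Phi>2 B"
    and q [measurable]: "q \<in> borel_measurable borel" and q01: "\<And>x. q x \<in> {0, 1}"
    and a1: "(\<lambda>n. \<integral>\<omega>. retention \<kappa>1 X1 q n \<omega> \<partial>M1) \<longlonglongrightarrow> a1"
    and a2: "(\<lambda>n. \<integral>\<omega>. retention \<kappa>2 X2 q n \<omega> \<partial>M2) \<longlonglongrightarrow> a2"
  shows "a1 \<le> a2"
proof -
  define B where "B m = {x. norm x \<le> real m \<and> q x = 0}" for m
  have B: "bounded_borel (B m)" for m
  proof
    show "B m \<in> sets borel"
      unfolding B_def by measurable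
    show "bounded (B m)"
      by (rule bounded_subset[OF bounded_cball[of 0 "real m"]]) (auto simp: B_def)
  qed
  show ?thesis
  proof (rule generating_functional_le_approx[where g = "\<lambda>m x. 1 - indicator (B m) x",
        OF enumerates_germs[OF P1] enumerates_germs[OF P2] q _ _ _ _ _ a1 a2
          tendsto_retention_void[OF P1 B] tendsto_retention_void[OF P2 B] le[OF B]])
    show "0 \<le> q x" for x
      using q01[of x] by auto
    show "(\<lambda>x. 1 - indicator (B m) x :: real) \<in> borel_measurable borel" for m
      using B[of m] by (auto intro!: borel_measurable_diff borel_measurable_indicator)
    show "q x \<le> 1 - indicator (B m) x" for m x
      using q01[of x] by (auto simp: B_def indicator_def)
    show "(\<lambda>m. 1 - indicator (B m) x) \<longlonglongrightarrow> q x" for x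
    proof (rule tendsto_eventually)
      show "eventually (\<lambda>m. 1 - indicator (B m) x = q x) sequentially"
        using eventually_ge_at_top[of "nat \<lceil>norm x\<rceil>"]
      proof eventually_elim
        case (elim m)
        then have "norm x \<le> real m"
          by linarith
        then show ?case
          using q01[of x] by (auto simp: B_def)
      qed
    qed
  qed (simp add: indicator_def)
qed

section \<open>Comparison of vacancy probabilities\<close>

text \<open>The union of the grains misses a set iff every single grain does. Vacancy is therefore a
  condition on each marked germ separately, to which the product formula for i.i.d. marks
  applies.\<close>

lemma vacancy_generating_functional:
  fixes G :: "'v \<Rightarrow> (real ^ 'd) set" and r :: real
  assumes bm: "boolean_model M \<Phi> \<kappa> X N G"
    and "countable \<K>" "\<And>K. K \<in> \<K> \<Longrightarrow> compact K"
  defines "q \<equiv> \<lambda>x. measure N {v \<in> space N. (+) x ` fatten r (G v) \<inter> \<Union>\<K> = {}}"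
  shows "q \<in> borel_measurable borel"
    and "(\<lambda>n. \<integral>\<omega>. retention \<kappa> X q n \<omega> \<partial>M) \<longlonglongrightarrow>
      measure (germ_grain_space M N) {\<xi> \<in> space (germ_grain_space M N).
        boolean_set \<kappa> X (\<lambda>v. fatten r (G v)) \<xi> \<inter> \<Union>\<K> = {}}"
proof -
  interpret germs M \<kappa> X
    using bm by (auto simp: boolean_model_def intro: enumerates_germs)
  have G: "random_closed_set N G"
    using bm by (simp add: boolean_model_def)
  then interpret N: prob_space N
    by (simp add: random_closed_set_def)
  define H where "H = {p \<in> space (borel \<Otimes>\<^sub>M N). (+) (fst p) ` fatten r (G (snd p)) \<inter> \<Union>\<K> = {}}"
  have H: "H \<in> sets (borel \<Otimes>\<^sub>M N)"
    unfolding H_def using assms G by (intro sets_translate_fatten_misses)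
  have q: "q = (\<lambda>x. measure N (Pair x -` H))"
    unfolding q_def H_def by (auto simp: space_pair_measure vimage_def)
  show "q \<in> borel_measurable borel"
    unfolding q using N.measurable_emeasure_Pair[OF H] by (simp add: measure_def)
  have "{\<xi> \<in> space (germ_grain_space M N). boolean_set \<kappa> X (\<lambda>v. fatten r (G v)) \<xi> \<inter> \<Union>\<K> = {}} =
      {\<xi> \<in> space (germ_grain_space M N). \<forall>i. enat i < \<kappa> (fst \<xi>) \<longrightarrow> (X i (fst \<xi>), snd \<xi> i) \<in> H}"
  proof (rule Collect_cong, rule conj_cong[OF refl])
    fix \<xi> assume "\<xi> \<in> space (germ_grain_space M N)"
    then have "snd \<xi> i \<in> space N" for i
      by (auto simp: germ_grain_space_def space_pair_measure space_PiM)
    then show "boolean_set \<kappa> X (\<lambda>v. fatten r (G v)) \<xi> \<inter> \<Union>\<K> = {} \<longleftrightarrow>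
        (\<forall>i. enat i < \<kappa> (fst \<xi>) \<longrightarrow> (X i (fst \<xi>), snd \<xi> i) \<in> H)"
      unfolding H_def boolean_set_def case_prod_beta Int_UN_distrib2 UNION_empty_conv
      by (simp add: space_pair_measure) blast
  qed
  then show "(\<lambda>n. \<integral>\<omega>. retention \<kappa> X q n \<omega> \<partial>M) \<longlonglongrightarrow>
      measure (germ_grain_space M N) {\<xi> \<in> space (germ_grain_space M N).
        boolean_set \<kappa> X (\<lambda>v. fatten r (G v)) \<xi> \<inter> \<Union>\<K> = {}}"
    using tendsto_integral_retention_iid[OF N.prob_space_axioms H] by (simp add: q)
qed

lemma prob_space_germ_grain_space:
  assumes "boolean_model M \<Phi> \<kappa> X N G"
  shows "prob_space (germ_grain_space M N)"
  using assms unfolding germ_grain_space_def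
  by (intro prob_space_pair prob_space_PiM)
    (simp_all add: boolean_model_def point_process_def random_closed_set_def)

text \<open>Termwise domination makes every radius admissible for the second model admissible for
  the first, and the infimum over a larger set is smaller.\<close>

lemma upper_critical_radius_mono:
  assumes bm: "boolean_model M1 \<Phi>1 \<kappa>1 X1 N G" "boolean_model M2 \<Phi>2 \<kappa>2 X2 N G"
    and le: "\<And>r n \<gamma>. \<gamma> \<in> contours n \<Longrightarrow>
      measure (germ_grain_space M1 N) {\<xi> \<in> space (germ_grain_space M1 N).
        boolean_set \<kappa>1 X1 (\<lambda>v. fatten r (G v)) \<xi> \<inter> Q_set n \<gamma> = {}}
      \<le> measure (germ_grain_space M2 N) {\<xi> \<in> space (germ_grain_space M2 N).
        boolean_set \<kappa>2 X2 (\<lambda>v. fatten r (G v)) \<xi> \<inter> Q_set n \<gamma> = {}}"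
  shows "upper_critical_radius M1 \<kappa>1 X1 N G \<le> upper_critical_radius M2 \<kappa>2 X2 N G"
proof -
  interpret S1: prob_space "germ_grain_space M1 N"
    by (rule prob_space_germ_grain_space[OF bm(1)])
  interpret S2: prob_space "germ_grain_space M2 N"
    by (rule prob_space_germ_grain_space[OF bm(2)])
  have *: "Inf {ereal r |r. 0 < r \<and> (\<forall>n\<ge>1. s1 r n < \<infinity>)} \<le> Inf {ereal r |r. 0 < r \<and> (\<forall>n\<ge>1. s2 r n < \<infinity>)}"
    if "\<And>r n. s1 r n \<le> s2 r n" for s1 s2 :: "real \<Rightarrow> nat \<Rightarrow> ennreal"
    by (rule Inf_superset_mono) (use that le_less_trans in blast)
  show ?thesis
    unfolding upper_critical_radius_def
    \<comment> \<open>Families in \<open>ennreal\<close> are always summable, so the sums compare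
      without further conditions.\<close>
    by (intro * infsum_mono nonneg_summable_on_complete)
      (auto simp: S1.emeasure_eq_measure S2.emeasure_eq_measure intro!: ennreal_leI le)
qed

theorem corollary4p2:
  fixes M1 :: "'w1 measure" and M2 :: "'w2 measure" and N :: "'v measure"
    and \<Phi>1 :: "'w1 \<Rightarrow> (real ^ 'd) measure" and \<Phi>2 :: "'w2 \<Rightarrow> (real ^ 'd) measure"
    and \<kappa>1 :: "'w1 \<Rightarrow> enat" and \<kappa>2 :: "'w2 \<Rightarrow> enat"
    and X1 :: "nat \<Rightarrow> 'w1 \<Rightarrow> real ^ 'd" and X2 :: "nat \<Rightarrow> 'w2 \<Rightarrow> real ^ 'd"
    and G :: "'v \<Rightarrow> (real ^ 'd) set"
  assumes "boolean_model M1 \<Phi>1 \<kappa>1 X1 N G" and "boolean_model M2 \<Phi>2 \<kappa>2 X2 N G"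
    and "simple_process M1 \<Phi>1" and "simple_process M2 \<Phi>2"
    and "locally_finite_moments M1 \<Phi>1" and "locally_finite_moments M2 \<Phi>2"
  shows "(dcx_le M1 \<Phi>1 M2 \<Phi>2 \<longrightarrow>
           upper_critical_radius M1 \<kappa>1 X1 N G \<le> upper_critical_radius M2 \<kappa>2 X2 N G) \<and>
         ((\<exists>K. compact K \<and> (AE v in N. G v = K)) \<longrightarrow>
           (\<forall>B. bounded_borel B \<longrightarrow> void_prob M1 \<Phi>1 B \<le> void_prob M2 \<Phi>2 B) \<longrightarrow>
           upper_critical_radius M1 \<kappa>1 X1 N G \<le> upper_critical_radius M2 \<kappa>2 X2 N G)"
proof -
  have bm1: "point_process M1 \<Phi>1" "enumerates M1 \<Phi>1 \<kappa>1 X1"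
    and bm2: "point_process M2 \<Phi>2" "enumerates M2 \<Phi>2 \<kappa>2 X2"
    and "prob_space N"
    using assms(1,2) by (auto simp: boolean_model_def random_closed_set_def)
  then interpret N: prob_space N
    by simp
  have "upper_critical_radius M1 \<kappa>1 X1 N G \<le> upper_critical_radius M2 \<kappa>2 X2 N G"
    if dcx: "dcx_le M1 \<Phi>1 M2 \<Phi>2"
  proof (rule upper_critical_radius_mono[OF assms(1,2)])
    fix r n and \<gamma> :: "(real ^ 'd) set" assume "\<gamma> \<in> contours n"
    then obtain \<K> where \<K>: "countable \<K>" "\<And>K. K \<in> \<K> \<Longrightarrow> compact K" and Q: "Q_set n \<gamma> = \<Union>\<K>"
      by (rule Q_set_sigma_compact) (rule that)
    note v1 = vacancy_generating_functional[OF assms(1) \<K>, of r]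
    note v2 = vacancy_generating_functional[OF assms(2) \<K>, of r]
    show "measure (germ_grain_space M1 N) {\<xi> \<in> space (germ_grain_space M1 N).
        boolean_set \<kappa>1 X1 (\<lambda>v. fatten r (G v)) \<xi> \<inter> Q_set n \<gamma> = {}}
      \<le> measure (germ_grain_space M2 N) {\<xi> \<in> space (germ_grain_space M2 N).
        boolean_set \<kappa>2 X2 (\<lambda>v. fatten r (G v)) \<xi> \<inter> Q_set n \<gamma> = {}}"
      unfolding Q
      by (rule dcx_le_generating_functional[OF bm1 bm2 dcx v1(1) _ _ v1(2) v2(2)]) auto
  qed
  moreover have "upper_critical_radius M1 \<kappa>1 X1 N G \<le> upper_critical_radius M2 \<kappa>2 X2 N G"
    if K: "AE v in N. G v = K"
      and void: "\<And>B. bounded_borel B \<Longrightarrow> void_prob M1 \<Phi>1 B \<le> void_prob M2 \<Phi>2 B" for K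
  proof (rule upper_critical_radius_mono[OF assms(1,2)])
    fix r n and \<gamma> :: "(real ^ 'd) set" assume "\<gamma> \<in> contours n"
    then obtain \<K> where \<K>: "countable \<K>" "\<And>K. K \<in> \<K> \<Longrightarrow> compact K" and Q: "Q_set n \<gamma> = \<Union>\<K>"
      by (rule Q_set_sigma_compact) (rule that)
    note v1 = vacancy_generating_functional[OF assms(1) \<K>, of r]
    note v2 = vacancy_generating_functional[OF assms(2) \<K>, of r]
    \<comment> \<open>An almost surely constant grain makes each single-germ vacancy event
      trivial.\<close>
    have q01: "measure N {v \<in> space N. (+) x ` fatten r (G v) \<inter> \<Union>\<K> = {}} \<in> {0, 1}"
      (is "measure N ?V \<in> _") for x
    \<comment> \<open>A set outside \<open>sets N\<close> has \<open>measure\<close> 0 by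
      convention, so that case also gives a value in \<open>{0, 1}\<close>.\<close>
    proof (cases "?V \<in> sets N")
      case True
      show ?thesis
      proof (cases "(+) x ` fatten r K \<inter> \<Union>\<K> = {}")
        case miss: True
        then have "AE v in N. (+) x ` fatten r (G v) \<inter> \<Union>\<K> = {}"
          using K by auto
        then show ?thesis
          using N.prob_Collect_eq_1[OF True] by simp
      next
        case hit: False
        then have "AE v in N. \<not> (+) x ` fatten r (G v) \<inter> \<Union>\<K> = {}"
          using K by auto
        then show ?thesis
          using N.prob_Collect_eq_0[OF True] by simp
      qed
    qed (simp add: measure_notin_sets)
    show "measure (germ_grain_space M1 N) {\<xi> \<in> space (germ_grain_space M1 N).
        boolean_set \<kappa>1 X1 (\<lambda>v. fatten r (G v)) \<xi> \<inter> Q_set n \<gamma> = {}}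
      \<le> measure (germ_grain_space M2 N) {\<xi> \<in> space (germ_grain_space M2 N).
        boolean_set \<kappa>2 X2 (\<lambda>v. fatten r (G v)) \<xi> \<inter> Q_set n \<gamma> = {}}"
      unfolding Q
      by (rule void_prob_le_generating_functional[OF bm1 bm2 void v1(1) q01 v1(2) v2(2)])
  qed
  ultimately show ?thesis
    by blast
qed

end
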